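(* For nonnegative integers $m,n$, let $V_{m,n}\subset\mathbb{C}$ be a configuration consisting of the origin $0$, $m$ points on the positive real axis, and $n$ points on the positive imaginary axis, and let $v_{m,n}=|\textsc{NC}(V_{m,n})|$. Then \[\sum_{m,n\ge 0}v_{m,n}x^my^n=\frac{1}{1-2x-2y+3xy}.\]
   Context: For a finite set $P\subset\mathbb{C}$, a partition of $P$ is noncrossing if the convex hulls of its blocks are pairwise disjoint; $\textsc{NC}(P)$ denotes the set of noncrossing partitions of $P$. *)

theory Defs
  imports
    "HOL-Analysis.Analysis"
    "HOL-Library.Disjoint_Sets"
    "HOL-Computational_Algebra.Formal_Power_Series"
begin

definition NC :: "complex set \<Rightarrow> complex set set set" where
  "NC P = {\<pi>. partition_on P \<pi> \<and> pairwise (\<lambda>A B. convex hull A \<inter> convex hull B = {}) \<pi>}"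

definition pos_real_axis :: "complex set" where
  "pos_real_axis = {z. Re z > 0 \<and> Im z = 0}"

definition pos_imag_axis :: "complex set" where
  "pos_imag_axis = {z. Re z = 0 \<and> Im z > 0}"

definition is_V_config :: "nat \<Rightarrow> nat \<Rightarrow> complex set \<Rightarrow> bool" where
  "is_V_config m n V \<longleftrightarrow>
     (\<exists>A B. finite A \<and> card A = m \<and> A \<subseteq> pos_real_axis \<and>
            finite B \<and> card B = n \<and> B \<subseteq> pos_imag_axis \<and>
            V = {0} \<union> A \<union> B)"

text \<open>
  Bivariate formal power series in \<open>x\<close> and \<open>y\<close> are rendered as power series in \<open>y\<close> whose
  coefficients are power series in \<open>x\<close>. Division is that of the type \<open>rat fps fps\<close>; it is a genuine
  inverse whenever the constant coefficient (here a series in \<open>x\<close>) has nonzero constant term.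
\<close>

definition fps_x :: "rat fps fps" where
  "fps_x = fps_const fps_X"

definition fps_y :: "rat fps fps" where
  "fps_y = fps_X"

definition bivariate_gf :: "(nat \<Rightarrow> nat \<Rightarrow> rat) \<Rightarrow> rat fps fps" where
  "bivariate_gf a = Abs_fps (\<lambda>n. Abs_fps (\<lambda>m. a m n))"

end

theory Submission
  imports Defs
begin

text \<open>
  Let \<open>a\<close> and \<open>b\<close> be the outermost points of \<open>V\<close> on the two axes. Making \<open>a\<close> a singleton block, or
  adjoining it to the block of its predecessor on the axis, turns any noncrossing partition of
  \<open>V - {a}\<close> into one of \<open>V\<close>; likewise for \<open>b\<close>, and both choices are independent. A partition that
  arises in neither way from \<open>a\<close> nor from \<open>b\<close> has \<open>{a, b}\<close> as a block, since otherwise two segments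
  joining the axes would cross. By inclusion-exclusion
  \<open>v m n = 2 v (m - 1) n + 2 v m (n - 1) - 4 v (m - 1) (n - 1) + v (m - 1) (n - 1)\<close>.
\<close>

section \<open>Disjoint convex hulls\<close>

text \<open>Fixing \<open>f\<close> as the coordinate along an axis and \<open>g\<close> as the
  other one lets each argument about a single axis serve the real and the imaginary axis
  alike.\<close>

definition axis_coords :: "(complex \<Rightarrow> real) \<Rightarrow> (complex \<Rightarrow> real) \<Rightarrow> bool" where
  "axis_coords f g \<longleftrightarrow> (f = Re \<and> g = Im) \<or> (f = Im \<and> g = Re)"

lemma axis_coords_simps [simp]: "axis_coords Re Im" "axis_coords Im Re"
  by (simp_all add: axis_coords_def)

text \<open>An open half-plane and its complementary closed half-plane are convex, so each contains
  the hull of the set on its side. Strictness on one side is enough.\<close>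

lemma hulls_disjointI:
  assumes fg: "axis_coords f g"
    and A: "\<And>z. z \<in> A \<Longrightarrow> \<alpha> * f z + \<beta> * g z < c"
    and B: "\<And>z. z \<in> B \<Longrightarrow> c \<le> \<alpha> * f z + \<beta> * g z"
  shows "convex hull A \<inter> convex hull B = {}"
proof -
  obtain w where w: "\<And>z. \<alpha> * f z + \<beta> * g z = w \<bullet> z"
  proof (cases "f = Re \<and> g = Im")
    case True
    then show ?thesis by (intro that[of "Complex \<alpha> \<beta>"]) (simp add: inner_complex_def)
  next
    case False
    then have "f = Im \<and> g = Re" using fg by (auto simp: axis_coords_def)
    then show ?thesis by (intro that[of "Complex \<beta> \<alpha>"]) (simp add: inner_complex_def)
  qed
  have "convex hull A \<subseteq> {z. w \<bullet> z < c}"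
    by (rule hull_minimal) (use A w in \<open>auto simp: convex_halfspace_lt\<close>)
  moreover have "convex hull B \<subseteq> {z. w \<bullet> z \<ge> c}"
    by (rule hull_minimal) (use B w in \<open>auto simp: convex_halfspace_ge\<close>)
  ultimately show ?thesis by force
qed

text \<open>Hulls of finite sets are compact, so hyperplane separation applies and is strict on both
  sides. All later crossing arguments become inequalities between values of a linear
  functional.\<close>

lemma hulls_disjointE:
  assumes fg: "axis_coords f g"
    and "finite A" "finite B" "B \<noteq> {}" "convex hull A \<inter> convex hull B = {}"
  obtains \<alpha> \<beta> c where "\<And>z. z \<in> A \<Longrightarrow> \<alpha> * f z + \<beta> * g z < c"
    and "\<And>z. z \<in> B \<Longrightarrow> c < \<alpha> * f z + \<beta> * g z"
proof -
  have "\<exists>w c. (\<forall>z\<in>convex hull A. w \<bullet> z < c) \<and> (\<forall>z\<in>convex hull B. c < w \<bullet> z)"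
    using assms by (intro separating_hyperplane_closed_compact)
      (auto simp: finite_imp_compact_convex_hull compact_imp_closed convex_convex_hull)
  then obtain w c where A: "\<And>z. z \<in> A \<Longrightarrow> w \<bullet> z < c" and B: "\<And>z. z \<in> B \<Longrightarrow> c < w \<bullet> z"
    by (meson hull_inc)
  show ?thesis
  proof (cases "f = Re \<and> g = Im")
    case True
    then show ?thesis using that[of "Re w" "Im w" c] A B by (auto simp: inner_complex_def)
  next
    case False
    then have "f = Im \<and> g = Re" using fg by (auto simp: axis_coords_def)
    then show ?thesis using that[of "Im w" "Re w" c] A B
      by (auto simp: inner_complex_def add.commute)
  qed
qed

section \<open>Noncrossing partitions and removal of points\<close>

lemma NC_partition: "\<pi> \<in> NC P \<Longrightarrow> partition_on P \<pi>"
  by (simp add: NC_def)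

lemma NC_block_subset: "\<pi> \<in> NC P \<Longrightarrow> B \<in> \<pi> \<Longrightarrow> B \<subseteq> P"
  by (auto simp: NC_def partition_on_def)

lemma NC_hulls:
  "\<pi> \<in> NC P \<Longrightarrow> A \<in> \<pi> \<Longrightarrow> B \<in> \<pi> \<Longrightarrow> A \<noteq> B \<Longrightarrow> convex hull A \<inter> convex hull B = {}"
  by (auto simp: NC_def pairwise_def)

lemma NC_block_unique:
  "\<pi> \<in> NC P \<Longrightarrow> A \<in> \<pi> \<Longrightarrow> B \<in> \<pi> \<Longrightarrow> z \<in> A \<Longrightarrow> z \<in> B \<Longrightarrow> A = B"
  using NC_hulls[of \<pi> P A B] hull_inc[of z A convex] hull_inc[of z B convex] by blast

lemma NC_obtain_block:
  assumes "\<pi> \<in> NC P" "z \<in> P"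
  obtains B where "B \<in> \<pi>" "z \<in> B"
  using assms by (auto simp: NC_def partition_on_def)

text \<open>Disjoint hulls already force disjoint blocks, so the hull condition is the only pairwise
  property to check.\<close>

lemma NC_I:
  assumes "\<Union>\<pi> = P" "{} \<notin> \<pi>"
    and "\<And>A B. A \<in> \<pi> \<Longrightarrow> B \<in> \<pi> \<Longrightarrow> A \<noteq> B \<Longrightarrow> convex hull A \<inter> convex hull B = {}"
  shows "\<pi> \<in> NC P"
proof -
  have "A \<inter> B = {}" if "A \<in> \<pi>" "B \<in> \<pi>" "A \<noteq> B" for A B
    using assms(3)[OF that] hull_subset[of A convex] hull_subset[of B convex] by blast
  then show ?thesis
    using assms by (auto simp: NC_def partition_on_def pairwise_def disjnt_def)
qed

lemma finite_NC: "finite P \<Longrightarrow> finite (NC P)"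
  by (rule finite_subset[OF _ finitely_many_partition_on]) (auto simp: NC_def)

text \<open>Every block inside \<open>V - S\<close> has its hull inside the hull of
  \<open>V - S\<close>, hence away from that of \<open>S\<close>; the inverse map discards the block
  \<open>S\<close>. Applied later to a single outermost point and to the pair of outermost
  points.\<close>

lemma bij_betw_insert_block:
  assumes S: "S \<subseteq> V" "S \<noteq> {}" and hulls: "convex hull (V - S) \<inter> convex hull S = {}"
  shows "bij_betw (insert S) (NC (V - S)) {\<pi> \<in> NC V. S \<in> \<pi>}"
proof (rule bij_betw_byWitness[where f' = "\<lambda>\<sigma>. \<sigma> - {S}"])
  have "S \<notin> \<pi>" if "\<pi> \<in> NC (V - S)" for \<pi>
    using NC_block_subset[OF that] S by blast
  then show "\<forall>\<pi>\<in>NC (V - S). insert S \<pi> - {S} = \<pi>" by blast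
  show "\<forall>\<sigma>\<in>{\<pi> \<in> NC V. S \<in> \<pi>}. insert S (\<sigma> - {S}) = \<sigma>" by blast
  have "insert S \<pi> \<in> NC V" if \<pi>: "\<pi> \<in> NC (V - S)" for \<pi>
  proof (rule NC_I)
    show "\<Union>(insert S \<pi>) = V" "{} \<notin> insert S \<pi>"
      using NC_partition[OF \<pi>] S by (auto simp: partition_on_def)
    have *: "convex hull A \<inter> convex hull S = {}" if "A \<in> \<pi>" for A
      using hulls hull_mono[OF NC_block_subset[OF \<pi> that], of convex] by blast
    show "convex hull A \<inter> convex hull B = {}"
      if "A \<in> insert S \<pi>" "B \<in> insert S \<pi>" "A \<noteq> B" for A B
      using that * NC_hulls[OF \<pi>] by (metis Int_commute insertE)
  qed
  then show "insert S ` NC (V - S) \<subseteq> {\<pi> \<in> NC V. S \<in> \<pi>}" by auto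
  have "\<sigma> - {S} \<in> NC (V - S)" if \<sigma>: "\<sigma> \<in> NC V" "S \<in> \<sigma>" for \<sigma>
  proof (rule NC_I)
    have "A \<inter> S = {}" if "A \<in> \<sigma>" "A \<noteq> S" for A
      using NC_block_unique[OF \<sigma>(1) that(1) \<sigma>(2)] that by blast
    then show "\<Union>(\<sigma> - {S}) = V - S"
      using NC_partition[OF \<sigma>(1)] by (force simp: partition_on_def)
    show "{} \<notin> \<sigma> - {S}" using NC_partition[OF \<sigma>(1)] by (auto simp: partition_on_def)
  qed (use NC_hulls[OF \<sigma>(1)] in auto)
  then show "(\<lambda>\<sigma>. \<sigma> - {S}) ` {\<pi> \<in> NC V. S \<in> \<pi>} \<subseteq> NC (V - S)" by auto
qed

definition adjoin :: "'a \<Rightarrow> 'a \<Rightarrow> 'a set set \<Rightarrow> 'a set set" where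
  "adjoin p q \<pi> = (\<lambda>B. if q \<in> B then insert p B else B) ` \<pi>"

definition together :: "'a \<Rightarrow> 'a \<Rightarrow> 'a set set \<Rightarrow> bool" where
  "together p q \<pi> \<longleftrightarrow> (\<exists>B\<in>\<pi>. p \<in> B \<and> q \<in> B)"

text \<open>The inverse map deletes \<open>p\<close> from every block. Only the block of
  \<open>q\<close> grows, so the geometry enters solely through \<open>ext\<close>: enlarging that
  block by \<open>p\<close> creates no new crossing.\<close>

lemma bij_betw_adjoin:
  assumes pq: "p \<in> V" "q \<in> V" "p \<noteq> q"
    and ext: "\<And>Q R. Q \<subseteq> V - {p} \<Longrightarrow> R \<subseteq> V - {p} \<Longrightarrow> q \<in> Q \<Longrightarrow> R \<noteq> {} \<Longrightarrow>
      convex hull Q \<inter> convex hull R = {} \<Longrightarrow> convex hull (insert p Q) \<inter> convex hull R = {}"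
  shows "bij_betw (adjoin p q) (NC (V - {p})) {\<pi> \<in> NC V. together p q \<pi>}"
proof (rule bij_betw_byWitness[where f' = "\<lambda>\<sigma>. (\<lambda>B. B - {p}) ` \<sigma>"])
  have "(\<lambda>B. B - {p}) ` adjoin p q \<pi> = \<pi>" if \<pi>: "\<pi> \<in> NC (V - {p})" for \<pi>
  proof -
    have "(if q \<in> B then insert p B else B) - {p} = B" if "B \<in> \<pi>" for B
      using NC_block_subset[OF \<pi> that] by auto
    then have "(\<lambda>B. (if q \<in> B then insert p B else B) - {p}) ` \<pi> = (\<lambda>B. B) ` \<pi>"
      by (intro image_cong refl)
    then show ?thesis by (simp only: adjoin_def image_image image_ident)
  qed
  then show "\<forall>\<pi>\<in>NC (V - {p}). (\<lambda>B. B - {p}) ` adjoin p q \<pi> = \<pi>" by blast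
  have "adjoin p q ((\<lambda>B. B - {p}) ` \<sigma>) = \<sigma>" if \<sigma>: "\<sigma> \<in> NC V" "together p q \<sigma>" for \<sigma>
  proof -
    have "p \<in> B \<longleftrightarrow> q \<in> B" if "B \<in> \<sigma>" for B
      using \<sigma> NC_block_unique[OF \<sigma>(1) that] unfolding together_def by metis
    then have "(if q \<in> B - {p} then insert p (B - {p}) else B - {p}) = B" if "B \<in> \<sigma>" for B
      using that pq by auto
    then have "(\<lambda>B. if q \<in> B - {p} then insert p (B - {p}) else B - {p}) ` \<sigma> = (\<lambda>B. B) ` \<sigma>"
      by (intro image_cong refl)
    then show ?thesis by (simp only: adjoin_def image_image image_ident)
  qed
  then show "\<forall>\<sigma>\<in>{\<pi> \<in> NC V. together p q \<pi>}. adjoin p q ((\<lambda>B. B - {p}) ` \<sigma>) = \<sigma>" by blast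
  have "adjoin p q \<pi> \<in> NC V \<and> together p q (adjoin p q \<pi>)" if \<pi>: "\<pi> \<in> NC (V - {p})" for \<pi>
  proof
    obtain Q where Q: "Q \<in> \<pi>" "q \<in> Q" using NC_obtain_block[OF \<pi>, of q] pq by blast
    have Q_iff: "q \<in> B \<longleftrightarrow> B = Q" if "B \<in> \<pi>" for B
      using NC_block_unique[OF \<pi> that Q(1)] Q by blast
    have adj: "adjoin p q \<pi> = insert (insert p Q) (\<pi> - {Q})"
      using Q Q_iff by (auto simp: adjoin_def image_iff)
    show "together p q (adjoin p q \<pi>)" using Q by (auto simp: adj together_def)
    have un: "\<Union>\<pi> = V - {p}" and ne: "{} \<notin> \<pi>"
      using NC_partition[OF \<pi>] by (auto simp: partition_on_def)
    show "adjoin p q \<pi> \<in> NC V"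
    proof (rule NC_I)
      have "\<Union>(adjoin p q \<pi>) = insert p (\<Union>\<pi>)" unfolding adj using Q(1) by blast
      then show "\<Union>(adjoin p q \<pi>) = V" using un pq by auto
      show "{} \<notin> adjoin p q \<pi>" using ne by (auto simp: adj)
      have *: "convex hull (insert p Q) \<inter> convex hull R = {}" if "R \<in> \<pi> - {Q}" for R
      proof -
        have "R \<noteq> {}" using that ne by auto
        then show ?thesis
          using that Q NC_block_subset[OF \<pi>] NC_hulls[OF \<pi> Q(1)] by (intro ext) auto
      qed
      show "convex hull A \<inter> convex hull B = {}"
        if AB: "A \<in> adjoin p q \<pi>" "B \<in> adjoin p q \<pi>" "A \<noteq> B" for A B
      proof -
        consider "A = insert p Q" "B \<in> \<pi> - {Q}" | "B = insert p Q" "A \<in> \<pi> - {Q}"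
          | "A \<in> \<pi>" "B \<in> \<pi>"
          using AB unfolding adj by blast
        then show ?thesis
          using *[of A] *[of B] NC_hulls[OF \<pi>] AB(3) by cases (simp_all add: Int_commute)
      qed
    qed
  qed
  then show "adjoin p q ` NC (V - {p}) \<subseteq> {\<pi> \<in> NC V. together p q \<pi>}" by auto
  have "(\<lambda>B. B - {p}) ` \<sigma> \<in> NC (V - {p})" if \<sigma>: "\<sigma> \<in> NC V" "together p q \<sigma>" for \<sigma>
  proof (rule NC_I)
    have un: "\<Union>\<sigma> = V" and ne: "{} \<notin> \<sigma>"
      using NC_partition[OF \<sigma>(1)] by (auto simp: partition_on_def)
    show "\<Union>((\<lambda>B. B - {p}) ` \<sigma>) = V - {p}" using un by auto
    have "q \<in> B" if "B \<in> \<sigma>" "p \<in> B" for B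
      using \<sigma> NC_block_unique[OF \<sigma>(1) that(1)] that unfolding together_def by metis
    then have "B - {p} \<noteq> {}" if "B \<in> \<sigma>" for B
      using that ne pq(3) by (cases "p \<in> B") auto
    then show "{} \<notin> (\<lambda>B. B - {p}) ` \<sigma>" by force
    have "convex hull (A - {p}) \<inter> convex hull (B - {p}) = {}"
      if "A \<in> \<sigma>" "B \<in> \<sigma>" "A \<noteq> B" for A B
      using NC_hulls[OF \<sigma>(1) that] hull_mono[of "A - {p}" A convex] hull_mono[of "B - {p}" B convex]
      by blast
    then show "convex hull A \<inter> convex hull B = {}"
      if "A \<in> (\<lambda>B. B - {p}) ` \<sigma>" "B \<in> (\<lambda>B. B - {p}) ` \<sigma>" "A \<noteq> B" for A B
      using that by blast
  qed
  then show "(\<lambda>\<sigma>. (\<lambda>B. B - {p}) ` \<sigma>) ` {\<pi> \<in> NC V. together p q \<pi>} \<subseteq> NC (V - {p})" by auto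
qed

lemma card_Collect_bij_betw:
  assumes "bij_betw h X Y" "\<And>x. x \<in> X \<Longrightarrow> C (h x) \<longleftrightarrow> C x"
  shows "card {y \<in> Y. C y} = card {x \<in> X. C x}"
proof -
  have "h ` {x \<in> X. C x} = {y \<in> Y. C y}" and "inj_on h {x \<in> X. C x}"
    using assms by (auto simp: bij_betw_def inj_on_def)
  then show ?thesis by (metis card_image)
qed

section \<open>Outermost points\<close>

text \<open>The point \<open>p\<close> is the last one of \<open>V\<close> on the \<open>f\<close>-axis and \<open>q\<close>, possibly the origin,
  is its predecessor.\<close>

definition outermost ::
    "(complex \<Rightarrow> real) \<Rightarrow> (complex \<Rightarrow> real) \<Rightarrow> complex set \<Rightarrow> complex \<Rightarrow> complex \<Rightarrow> bool" where
  "outermost f g V p q \<longleftrightarrow> axis_coords f g \<and> finite V \<and>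
     (\<forall>z\<in>V. 0 \<le> f z \<and> 0 \<le> g z \<and> (f z = 0 \<or> g z = 0)) \<and>
     p \<in> V \<and> q \<in> V \<and> g p = 0 \<and> g q = 0 \<and> f q < f p \<and> (\<forall>z\<in>V - {p}. f z \<le> f q)"

text \<open>These are the partitions obtained from one of \<open>V - {p}\<close> by one of the two
  extensions: a new singleton block, or \<open>p\<close> joined to its predecessor.\<close>

definition attached :: "complex \<Rightarrow> complex \<Rightarrow> complex set set \<Rightarrow> bool" where
  "attached p q \<pi> \<longleftrightarrow> {p} \<in> \<pi> \<or> together p q \<pi>"

lemma outermost_Diff:
  "outermost f g V p q \<Longrightarrow> p \<noteq> r \<Longrightarrow> q \<noteq> r \<Longrightarrow> outermost f g (V - {r}) p q"
  by (auto simp: outermost_def)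

text \<open>The coordinate \<open>f\<close> alone separates, being strictly largest at
  \<open>p\<close>.\<close>

lemma outermost_hull:
  assumes "outermost f g V p q"
  shows "convex hull (V - {p}) \<inter> convex hull {p} = {}"
  using assms
  by (intro hulls_disjointI[of f g _ 1 0 "f p"]) (auto simp: outermost_def intro: le_less_trans)

text \<open>This is the geometric hypothesis of \<open>bij_betw_adjoin\<close>. Take a functional
  that is below \<open>c\<close> on \<open>Q\<close> and above \<open>c\<close> on \<open>R\<close>.
  If its \<open>f\<close>-coefficient is nonpositive, moving outwards from \<open>q\<close> to
  \<open>p\<close> does not increase it, so it still separates; otherwise it has to be
  modified.\<close>

lemma outermost_extend:
  assumes out: "outermost f g V p q" and Q: "Q \<subseteq> V - {p}" "q \<in> Q"
    and R: "R \<subseteq> V - {p}" "R \<noteq> {}" and disj: "convex hull Q \<inter> convex hull R = {}"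
  shows "convex hull (insert p Q) \<inter> convex hull R = {}"
proof -
  have fg: "axis_coords f g" and V: "finite V"
    and pos: "\<And>z. z \<in> V \<Longrightarrow> 0 \<le> f z \<and> 0 \<le> g z \<and> (f z = 0 \<or> g z = 0)"
    and q: "q \<in> V" "g q = 0" and p: "g p = 0" "f q < f p"
    and le: "\<And>z. z \<in> V - {p} \<Longrightarrow> f z \<le> f q"
    using out by (auto simp: outermost_def)
  have "finite Q" "finite R" using Q R V by (auto intro: finite_subset)
  then obtain \<alpha> \<beta> c where A: "\<And>z. z \<in> Q \<Longrightarrow> \<alpha> * f z + \<beta> * g z < c"
    and B: "\<And>z. z \<in> R \<Longrightarrow> c < \<alpha> * f z + \<beta> * g z"
    using hulls_disjointE[OF fg _ _ R(2) disj] by metis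
  have Aq: "\<alpha> * f q < c" using A[OF Q(2)] q by simp
  show ?thesis
  proof (cases "\<alpha> \<le> 0")
    case True
    then have "\<alpha> * f p \<le> \<alpha> * f q" using p by (simp add: mult_left_mono_neg)
    then show ?thesis
      using A B Aq p by (intro hulls_disjointI[OF fg, of _ \<alpha> \<beta> c]) (auto intro: less_imp_le)
  next
    \<comment> \<open>Here \<open>R\<close> lies on the \<open>g\<close>-axis, so the \<open>f\<close>-part of the separating functional can be dropped.\<close>
    case False
    have c: "0 < c" using Aq False pos[OF q(1)] by (smt (verit) mult_nonneg_nonneg)
    \<comment> \<open>If \<open>g z = 0\<close>, the value at \<open>z\<close> would be at most
      \<open>\<alpha> * f q < c\<close>; hence \<open>f z = 0\<close>.\<close>
    have "c < \<beta> * g z" if z: "z \<in> R" for z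
    proof -
      have "z \<in> V" "f z \<le> f q" using z R le by auto
      moreover have "\<alpha> * f z \<le> \<alpha> * f q" using False \<open>f z \<le> f q\<close> by (simp add: mult_left_mono)
      ultimately show ?thesis using B[OF z] Aq pos[of z] by force
    qed
    \<comment> \<open>Where \<open>f z = 0\<close> nothing was dropped; where \<open>g z = 0\<close>
      the claim is \<open>0 < c\<close>.\<close>
    moreover have "\<beta> * g z < c" if z: "z \<in> Q" for z
      using A[OF z] pos[of z] z Q(1) c by force
    ultimately show ?thesis
      using c p by (intro hulls_disjointI[OF fg, of _ 0 \<beta> c]) (auto intro: less_imp_le)
  qed
qed

text \<open>If another point \<open>z\<close> of the block were on the \<open>f\<close>-axis, then
  \<open>q\<close> would lie on the segment from \<open>z\<close> to \<open>p\<close>, and the block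
  of \<open>q\<close> would meet the hull of \<open>B\<close>.\<close>

lemma outermost_block_off_axis:
  assumes out: "outermost f g V p q" and \<pi>: "\<pi> \<in> NC V" and B: "B \<in> \<pi>" "p \<in> B" "q \<notin> B"
    and z: "z \<in> B" "z \<noteq> p"
  shows "0 < g z"
proof (rule ccontr)
  have fg: "axis_coords f g" and V: "finite V"
    and pos: "\<And>z. z \<in> V \<Longrightarrow> 0 \<le> f z \<and> 0 \<le> g z \<and> (f z = 0 \<or> g z = 0)"
    and q: "q \<in> V" "g q = 0" and p: "g p = 0" "f q < f p"
    and le: "\<And>z. z \<in> V - {p} \<Longrightarrow> f z \<le> f q"
    using out by (auto simp: outermost_def)
  assume "\<not> 0 < g z"
  have zV: "z \<in> V" using NC_block_subset[OF \<pi> B(1)] z by auto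
  then have gz: "g z = 0" using pos \<open>\<not> 0 < g z\<close> by force
  obtain B' where B': "B' \<in> \<pi>" "q \<in> B'" using NC_obtain_block[OF \<pi> q(1)] .
  then have "convex hull B \<inter> convex hull B' = {}" using NC_hulls[OF \<pi> B(1)] B(3) by blast
  moreover have "finite B" "finite B'"
    using NC_block_subset[OF \<pi>] B B' V by (auto intro: finite_subset)
  ultimately obtain \<alpha> \<beta> c where sep: "\<And>z. z \<in> B \<Longrightarrow> \<alpha> * f z + \<beta> * g z < c"
    "\<And>z. z \<in> B' \<Longrightarrow> c < \<alpha> * f z + \<beta> * g z"
    using hulls_disjointE[OF fg, of B B'] B'(2) by blast
  have "\<alpha> * f z < c" "\<alpha> * f p < c" "c < \<alpha> * f q"
    using sep(1)[OF z(1)] sep(1)[OF B(2)] sep(2)[OF B'(2)] gz p q by auto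
  moreover have "f z \<le> f q" using le zV z by auto
  \<comment> \<open>A linear function of \<open>f\<close> below \<open>c\<close> at
    \<open>f z\<close> and at \<open>f p\<close> cannot exceed \<open>c\<close> at
    \<open>f q\<close>, which lies between them.\<close>
  ultimately show False using p
    by (smt (verit) mult_left_mono mult_left_mono_neg)
qed

text \<open>The two extensions have disjoint images, and each is a bijection from the partitions of
  \<open>V - {p}\<close>. The condition \<open>C\<close> is one that both extensions preserve;
  taking it to be attachment on the other axis counts partitions attached on both axes.\<close>

lemma card_attached:
  assumes out: "outermost f g V p q"
    and C1: "\<And>\<pi>. C (insert {p} \<pi>) \<longleftrightarrow> C \<pi>"
    and C2: "\<And>\<pi>. \<pi> \<in> NC (V - {p}) \<Longrightarrow> C (adjoin p q \<pi>) \<longleftrightarrow> C \<pi>"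
  shows "card {\<pi> \<in> NC V. attached p q \<pi> \<and> C \<pi>} = 2 * card {\<pi> \<in> NC (V - {p}). C \<pi>}"
proof -
  have pq: "p \<in> V" "q \<in> V" "p \<noteq> q" and V: "finite V" using out by (auto simp: outermost_def)
  let ?S = "{\<pi> \<in> {\<pi> \<in> NC V. {p} \<in> \<pi>}. C \<pi>}"
  let ?T = "{\<pi> \<in> {\<pi> \<in> NC V. together p q \<pi>}. C \<pi>}"
  have "card ?S = card {\<pi> \<in> NC (V - {p}). C \<pi>}"
    by (rule card_Collect_bij_betw[OF bij_betw_insert_block])
      (use pq C1 outermost_hull[OF out] in auto)
  moreover have "card ?T = card {\<pi> \<in> NC (V - {p}). C \<pi>}"
    by (rule card_Collect_bij_betw[OF bij_betw_adjoin])
      (use pq C2 outermost_extend[OF out] in auto)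
  moreover have "{\<pi> \<in> NC V. attached p q \<pi> \<and> C \<pi>} = ?S \<union> ?T" by (auto simp: attached_def)
  moreover have "\<not> ({p} \<in> \<pi> \<and> together p q \<pi>)" if "\<pi> \<in> NC V" for \<pi>
    using NC_block_unique[OF that, of "{p}"] pq by (auto simp: together_def)
  then have "?S \<inter> ?T = {}" by blast
  moreover have "finite ?S" "finite ?T" using finite_NC[OF V] by auto
  ultimately show ?thesis by (simp add: card_Un_disjoint)
qed

lemma attached_insert_block: "r \<noteq> p \<Longrightarrow> r \<noteq> q \<Longrightarrow> attached r s (insert {p} \<pi>) \<longleftrightarrow> attached r s \<pi>"
  by (auto simp: attached_def together_def)

text \<open>An extension on one axis does not affect attachment on the other, which makes the two
  choices independent. The case \<open>s = q\<close> is covered, since both predecessors may be the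
  origin.\<close>

lemma attached_adjoin:
  assumes "r \<noteq> p" "r \<noteq> q" "s \<noteq> p" "p \<notin> \<Union>\<pi>"
  shows "attached r s (adjoin p q \<pi>) \<longleftrightarrow> attached r s \<pi>"
proof -
  have "{r} \<in> adjoin p q \<pi> \<longleftrightarrow> {r} \<in> \<pi>"
    using assms by (force simp: adjoin_def image_iff)
  moreover have "together r s (adjoin p q \<pi>) \<longleftrightarrow> together r s \<pi>"
    using assms by (auto simp: adjoin_def together_def)
  ultimately show ?thesis by (simp add: attached_def)
qed

section \<open>The recurrence\<close>

text \<open>By \<open>outermost_block_off_axis\<close>, an unattached \<open>a\<close> has only
  points of the positive imaginary axis as companions in its block, and at least one; symmetrically
  for \<open>b\<close>. Distinct blocks of this kind would cross, and a common one has no room for a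
  third point, whose coordinates would both be positive.\<close>

lemma not_attached_iff:
  assumes a: "outermost Re Im V a a'" and b: "outermost Im Re V b b'" and \<pi>: "\<pi> \<in> NC V"
  shows "\<not> attached a a' \<pi> \<and> \<not> attached b b' \<pi> \<longleftrightarrow> {a, b} \<in> \<pi>"
proof
  have V: "finite V"
    and pos: "\<And>z. z \<in> V \<Longrightarrow> 0 \<le> Re z \<and> 0 \<le> Im z \<and> (Re z = 0 \<or> Im z = 0)"
    and aV: "a \<in> V" "a' \<in> V" and bV: "b \<in> V" "b' \<in> V"
    and a0: "Im a = 0" "Im a' = 0" "Re a' < Re a" and b0: "Re b = 0" "Re b' = 0" "Im b' < Im b"
    and le_a: "\<And>z. z \<in> V - {a} \<Longrightarrow> Re z \<le> Re a'" and le_b: "\<And>z. z \<in> V - {b} \<Longrightarrow> Im z \<le> Im b'"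
    using a b by (auto simp: outermost_def)
  have bpos: "0 < Im b" and apos: "0 < Re a" using pos[OF bV(2)] pos[OF aV(2)] a0 b0 by auto
  have ne: "a \<noteq> b" "a' \<noteq> b" "b' \<noteq> a" "a \<noteq> a'" "b \<noteq> b'" using a0 b0 bpos apos by auto
  show "\<not> attached a a' \<pi> \<and> \<not> attached b b' \<pi>" if "{a, b} \<in> \<pi>"
  proof -
    have "B = {a, b}" if "B \<in> \<pi>" "a \<in> B \<or> b \<in> B" for B
      using NC_block_unique[OF \<pi> that(1) \<open>{a, b} \<in> \<pi>\<close>] that by auto
    then have "{a} \<notin> \<pi>" "{b} \<notin> \<pi>" "\<not> together a a' \<pi>" "\<not> together b b' \<pi>"
      using ne unfolding together_def by blast+
    then show ?thesis by (simp add: attached_def)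
  qed
  assume na: "\<not> attached a a' \<pi> \<and> \<not> attached b b' \<pi>"
  obtain A where A: "A \<in> \<pi>" "a \<in> A" using NC_obtain_block[OF \<pi> aV(1)] .
  obtain B where B: "B \<in> \<pi>" "b \<in> B" using NC_obtain_block[OF \<pi> bV(1)] .
  have nA: "a' \<notin> A" "A \<noteq> {a}" and nB: "b' \<notin> B" "B \<noteq> {b}"
    using na A B by (auto simp: attached_def together_def)
  have offA: "0 < Im z" if "z \<in> A" "z \<noteq> a" for z
    using outermost_block_off_axis[OF a \<pi> A nA(1)] that by blast
  have offB: "0 < Re z" if "z \<in> B" "z \<noteq> b" for z
    using outermost_block_off_axis[OF b \<pi> B nB(1)] that by blast
  have subV: "A \<subseteq> V" "B \<subseteq> V" using NC_block_subset[OF \<pi>] A B by auto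
  have "A = B"
  proof (rule ccontr)
    \<comment> \<open>Otherwise the segments from \<open>a\<close> to \<open>z\<close> and from \<open>b\<close> to \<open>w\<close> cross.\<close>
    assume "A \<noteq> B"
    obtain z where z: "z \<in> A" "z \<noteq> a" using nA A by blast
    obtain w where w: "w \<in> B" "w \<noteq> b" using nB B by blast
    have zw: "z \<in> V" "w \<in> V" using z w subV by auto
    have pz: "0 < Im z" "Re z = 0" and pw: "0 < Re w" "Im w = 0"
      using offA[OF z] offB[OF w] pos[OF zw(1)] pos[OF zw(2)] by auto
    have "b \<notin> A" "a \<notin> B"
      using NC_block_unique[OF \<pi> A(1) B(1)] A B \<open>A \<noteq> B\<close> by auto
    then have "z \<in> V - {b}" "w \<in> V - {a}" using zw z(1) w(1) by auto
    then have le: "Im z \<le> Im b" "Re w \<le> Re a"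
      using le_a[of w] le_b[of z] a0(3) b0(3) by auto
    have fin: "finite A" "finite B" using subV V by (auto intro: finite_subset)
    have "B \<noteq> {}" using B(2) by auto
    then obtain \<alpha> \<beta> c where sepA: "\<And>z. z \<in> A \<Longrightarrow> \<alpha> * Re z + \<beta> * Im z < c"
      and sepB: "\<And>z. z \<in> B \<Longrightarrow> c < \<alpha> * Re z + \<beta> * Im z"
      using hulls_disjointE[OF axis_coords_simps(1) fin _ NC_hulls[OF \<pi> A(1) B(1) \<open>A \<noteq> B\<close>]]
      by blast
    have sep: "\<alpha> * Re a < c" "\<beta> * Im z < c" "c < \<beta> * Im b" "c < \<alpha> * Re w"
      using sepA[OF A(2)] sepA[OF z(1)] sepB[OF B(2)] sepB[OF w(1)] a0(1) b0(1) pz(2) pw(2)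
      by simp_all
    \<comment> \<open>On the real axis the functional is larger at the nearer point \<open>w\<close>
      than at \<open>a\<close>, which forces \<open>\<alpha> < 0\<close> and so
      \<open>c < 0\<close>. On the imaginary axis it is larger at the farther point \<open>b\<close>
      than at \<open>z\<close>, which forces \<open>\<beta> > 0\<close> and so
      \<open>c > 0\<close>.\<close>
    have "\<alpha> < 0"
    proof (rule ccontr)
      assume "\<not> \<alpha> < 0"
      then have "\<alpha> * Re w \<le> \<alpha> * Re a" using le(2) by (simp add: mult_left_mono)
      then show False using sep by linarith
    qed
    then have "c < 0" using sep(4) mult_neg_pos[OF _ pw(1)] by fastforce
    have "0 < \<beta>"
    proof (rule ccontr)
      assume "\<not> 0 < \<beta>"
      then have "\<beta> * Im b \<le> \<beta> * Im z" using le(1) by (simp add: mult_left_mono_neg)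
      then show False using sep by linarith
    qed
    then have "0 < c" using sep(2) mult_pos_pos[OF _ pz(1)] by fastforce
    then show False using \<open>c < 0\<close> by simp
  qed
  have "z \<in> {a, b}" if z: "z \<in> A" for z
  proof (rule ccontr)
    assume "z \<notin> {a, b}"
    then have "0 < Im z" "0 < Re z" using offA[of z] offB[of z] z \<open>A = B\<close> by auto
    then show False using pos[of z] z subV by auto
  qed
  then have "A = {a, b}" using A B \<open>A = B\<close> by blast
  then show "{a, b} \<in> \<pi>" using A by simp
qed

text \<open>Inclusion-exclusion over attachment at \<open>a\<close> and at \<open>b\<close>: the
  intersection contributes 4 copies of the doubly reduced count and the complement of the union 1,
  which leaves the coefficient 3. The additive form avoids truncated subtraction on
  \<open>nat\<close>.\<close>

lemma card_NC_recurrence: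
  assumes a: "outermost Re Im V a a'" and b: "outermost Im Re V b b'"
  shows "card (NC V) + 3 * card (NC (V - {a} - {b})) =
    2 * card (NC (V - {a})) + 2 * card (NC (V - {b}))"
proof -
  have V: "finite V" and ab: "a \<in> V" "b \<in> V" "a' \<in> V" "b' \<in> V"
    and pos: "\<And>z. z \<in> V \<Longrightarrow> 0 \<le> Re z \<and> 0 \<le> Im z \<and> (Re z = 0 \<or> Im z = 0)"
    and a0: "Im a = 0" "Im a' = 0" "Re a' < Re a" and b0: "Re b = 0" "Re b' = 0" "Im b' < Im b"
    and le_a: "\<And>z. z \<in> V - {a} \<Longrightarrow> Re z \<le> Re a'" and le_b: "\<And>z. z \<in> V - {b} \<Longrightarrow> Im z \<le> Im b'"
    using a b by (auto simp: outermost_def)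
  have bpos: "0 < Im b" and apos: "0 < Re a" using pos[OF ab(3)] pos[OF ab(4)] a0 b0 by auto
  have ne: "a \<noteq> b" "a' \<noteq> b" "b' \<noteq> a" "a \<noteq> a'" "b \<noteq> b'" using a0 b0 bpos apos by auto
  let ?A = "{\<pi> \<in> NC V. attached a a' \<pi>}" and ?B = "{\<pi> \<in> NC V. attached b b' \<pi>}"
  have cA: "card ?A = 2 * card (NC (V - {a}))"
    using card_attached[OF a, of "\<lambda>_. True"] by simp
  have cB: "card ?B = 2 * card (NC (V - {b}))"
    using card_attached[OF b, of "\<lambda>_. True"] by simp
  have "card (?A \<inter> ?B) = card {\<pi> \<in> NC V. attached a a' \<pi> \<and> attached b b' \<pi>}"
    by (rule arg_cong[where f = card]) blast
  \<comment> \<open>First \<open>a\<close> is removed with attachment at \<open>b\<close> as the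
    preserved condition; then \<open>b\<close>, still outermost in \<open>V - {a}\<close>, is
    removed.\<close>
  also have "\<dots> = 2 * card {\<pi> \<in> NC (V - {a}). attached b b' \<pi>}"
  proof (rule card_attached[OF a])
    show "attached b b' (insert {a} \<pi>) \<longleftrightarrow> attached b b' \<pi>" for \<pi>
      using ne by (intro attached_insert_block[of b a a']) auto
    show "attached b b' (adjoin a a' \<pi>) \<longleftrightarrow> attached b b' \<pi>" if "\<pi> \<in> NC (V - {a})" for \<pi>
      using ne NC_block_subset[OF that] by (intro attached_adjoin) auto
  qed
  also have "\<dots> = 4 * card (NC (V - {a} - {b}))"
    using card_attached[OF outermost_Diff[OF b, of a], of "\<lambda>_. True"] ne by simp
  finally have cAB: "card (?A \<inter> ?B) = 4 * card (NC (V - {a} - {b}))" .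
  have "convex hull (V - {a, b}) \<inter> convex hull {a, b} = {}"
  \<comment> \<open>This functional equals 1 on the line through \<open>a\<close> and
    \<open>b\<close>; every other point of \<open>V\<close> lies strictly on the origin's
    side.\<close>
  proof (rule hulls_disjointI[of Re Im _ "1 / Re a" "1 / Im b" 1])
    show "1 / Re a * Re z + 1 / Im b * Im z < 1" if z: "z \<in> V - {a, b}" for z
    proof (cases "Re z = 0")
      case True
      have "Im z < Im b" using le_b[of z] z b0(3) by auto
      then show ?thesis using True bpos by simp
    next
      case False
      then have "Im z = 0" using pos[of z] z by auto
      moreover have "Re z < Re a" using le_a[of z] z a0(3) by auto
      ultimately show ?thesis using apos by simp
    qed
  qed (use a0 b0 apos bpos in auto)
  then have "card {\<pi> \<in> NC V. {a, b} \<in> \<pi>} = card (NC (V - {a, b}))"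
    using ab by (intro bij_betw_same_card[symmetric, OF bij_betw_insert_block]) auto
  moreover have "{\<pi> \<in> NC V. {a, b} \<in> \<pi>} = NC V - (?A \<union> ?B)"
    using not_attached_iff[OF a b] by blast
  moreover have "V - {a, b} = V - {a} - {b}" by blast
  ultimately have "card (NC V - (?A \<union> ?B)) = card (NC (V - {a} - {b}))" by simp
  moreover have "card (NC V) = card (?A \<union> ?B) + card (NC V - (?A \<union> ?B))"
  proof -
    have "?A \<union> ?B \<subseteq> NC V" by blast
    then show ?thesis
      using finite_NC[OF V] by (simp add: card_Diff_subset card_mono finite_subset)
  qed
  moreover have "card ?A + card ?B = card (?A \<union> ?B) + card (?A \<inter> ?B)"
    using finite_NC[OF V] by (intro card_Un_Int) auto
  ultimately show ?thesis using cA cB cAB by simp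
qed

text \<open>An unattached \<open>p\<close> would need a companion off the \<open>f\<close>-axis, so
  here every partition is attached.\<close>

lemma card_NC_one_axis:
  assumes out: "outermost f g V p q" and axis: "\<And>z. z \<in> V \<Longrightarrow> g z = 0"
  shows "card (NC V) = 2 * card (NC (V - {p}))"
proof -
  have "attached p q \<pi>" if \<pi>: "\<pi> \<in> NC V" for \<pi>
  proof (rule ccontr)
    assume na: "\<not> attached p q \<pi>"
    obtain B where B: "B \<in> \<pi>" "p \<in> B"
      using NC_obtain_block[OF \<pi>, of p] out by (auto simp: outermost_def)
    have "q \<notin> B" "B \<noteq> {p}" using na B by (auto simp: attached_def together_def)
    then obtain z where z: "z \<in> B" "z \<noteq> p" using B(2) by blast
    then have "0 < g z" using outermost_block_off_axis[OF out \<pi> B] \<open>q \<notin> B\<close> by blast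
    then show False using axis[of z] NC_block_subset[OF \<pi> B(1)] z by auto
  qed
  then have "{\<pi> \<in> NC V. attached p q \<pi>} = NC V" by blast
  then show ?thesis using card_attached[OF out, of "\<lambda>_. True"] by simp
qed

section \<open>Outermost points and point removal in configurations\<close>

lemma finite_ex_max:
  fixes f :: "'a \<Rightarrow> 'b::linorder"
  assumes "finite A" "A \<noteq> {}"
  shows "\<exists>p\<in>A. \<forall>z\<in>A. f z \<le> f p"
proof -
  have "Max (f ` A) \<in> f ` A" using assms by (intro Max_in) auto
  then obtain p where p: "p \<in> A" "Max (f ` A) = f p" by blast
  have "f z \<le> f p" if "z \<in> A" for z
    using Max_ge[of "f ` A" "f z"] assms(1) that p(2) by simp
  then show ?thesis using p(1) by blast
qed

text \<open>Choose \<open>p\<close> maximal on the \<open>f\<close>-axis and \<open>q\<close>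
  maximal among what remains there.\<close>

lemma ex_outermost:
  assumes fg: "axis_coords f g" and fin: "finite A" "finite B" and "A \<noteq> {}"
    and A: "A \<subseteq> {z. f z > 0 \<and> g z = 0}" and B: "B \<subseteq> {z. g z > 0 \<and> f z = 0}"
  shows "\<exists>p\<in>A. \<exists>q. outermost f g ({0} \<union> A \<union> B) p q"
proof -
  have f0: "f 0 = 0" "g 0 = 0" using fg by (auto simp: axis_coords_def)
  obtain p where p: "p \<in> A" "\<And>z. z \<in> A \<Longrightarrow> f z \<le> f p"
    using finite_ex_max[OF fin(1) \<open>A \<noteq> {}\<close>, of f] by blast
  \<comment> \<open>Including the origin provides a predecessor even when \<open>A\<close> is just
    \<open>{p}\<close>.\<close>
  let ?X = "insert 0 (A - {p})"
  have X: "finite ?X" "?X \<noteq> {}" using fin(1) by auto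
  obtain q where q: "q \<in> ?X" "\<And>z. z \<in> ?X \<Longrightarrow> f z \<le> f q"
    using finite_ex_max[OF X, of f] by blast
  have axis: "0 < f z" "g z = 0" if "z \<in> A" for z using A that by auto
  have g: "g q = 0" "g p = 0" "0 < f p" using p(1) q(1) axis f0 by auto
  have "q \<noteq> p" using q(1) g f0 by auto
  \<comment> \<open>Both have \<open>g\<close>-coordinate 0, so equal \<open>f\<close>-coordinates
    would make them equal.\<close>
  have "f q \<noteq> f p"
    using fg g \<open>q \<noteq> p\<close> by (auto simp: axis_coords_def complex_eq_iff)
  moreover have "f q \<le> f p" using q(1) p(2)[of q] g f0 by auto
  ultimately have "f q < f p" by simp
  moreover have "f z \<le> f q" if "z \<in> {0} \<union> A \<union> B - {p}" for z
  proof (cases "z \<in> B")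
    case True
    then have "f z = 0" using B by auto
    then show ?thesis using q(2)[of 0] f0 by simp
  next
    case False
    then show ?thesis using that by (intro q(2)) auto
  qed
  moreover have "\<forall>z\<in>{0} \<union> A \<union> B. 0 \<le> f z \<and> 0 \<le> g z \<and> (f z = 0 \<or> g z = 0)"
  proof
    fix z assume "z \<in> {0} \<union> A \<union> B"
    then consider "z = 0" | "z \<in> A" | "z \<in> B" by blast
    then show "0 \<le> f z \<and> 0 \<le> g z \<and> (f z = 0 \<or> g z = 0)"
      using A B f0 by cases (auto intro: less_imp_le)
  qed
  ultimately have "outermost f g ({0} \<union> A \<union> B) p q"
    using fg fin p(1) q(1) g(1,2) by (auto simp: outermost_def)
  then show ?thesis using p(1) by blast
qed

lemma V_configI:
  assumes "finite A" "A \<subseteq> pos_real_axis" "finite B" "B \<subseteq> pos_imag_axis" "V = {0} \<union> A \<union> B"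
  shows "is_V_config (card A) (card B) V"
  unfolding is_V_config_def using assms by (intro exI[of _ A] exI[of _ B] conjI refl)

lemma V_config_remove_real:
  assumes "is_V_config m n V" "a \<in> V" "0 < Re a"
  shows "is_V_config (m - 1) n (V - {a})"
proof -
  obtain A B where AB: "finite A" "card A = m" "A \<subseteq> pos_real_axis"
    "finite B" "card B = n" "B \<subseteq> pos_imag_axis" "V = {0} \<union> A \<union> B"
    using assms(1) unfolding is_V_config_def by blast
  have "a \<notin> B" "a \<noteq> 0" using assms(3) AB(6) by (auto simp: pos_imag_axis_def)
  then have a: "a \<in> A" "V - {a} = {0} \<union> (A - {a}) \<union> B" using assms(2) AB(7) by auto
  have "is_V_config (card (A - {a})) (card B) (V - {a})"
    using AB(1,3,4,6) a(2) by (intro V_configI) auto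
  then show ?thesis using AB(2,5) card_Diff_singleton[OF a(1)] by simp
qed

lemma V_config_remove_imag:
  assumes "is_V_config m n V" "b \<in> V" "0 < Im b"
  shows "is_V_config m (n - 1) (V - {b})"
proof -
  obtain A B where AB: "finite A" "card A = m" "A \<subseteq> pos_real_axis"
    "finite B" "card B = n" "B \<subseteq> pos_imag_axis" "V = {0} \<union> A \<union> B"
    using assms(1) unfolding is_V_config_def by blast
  have "b \<notin> A" "b \<noteq> 0" using assms(3) AB(3) by (auto simp: pos_real_axis_def)
  then have b: "b \<in> B" "V - {b} = {0} \<union> A \<union> (B - {b})" using assms(2) AB(7) by auto
  have "is_V_config (card A) (card (B - {b})) (V - {b})"
    using AB(1,3,4,6) b(2) by (intro V_configI) auto
  then show ?thesis using AB(2,5) card_Diff_singleton[OF b(1)] by simp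
qed

lemma V_config_ex_outermost_real:
  assumes "is_V_config (Suc m) n V"
  obtains a a' where "a \<in> V" "0 < Re a" "outermost Re Im V a a'"
proof -
  obtain A B where AB: "finite A" "card A = Suc m" "A \<subseteq> pos_real_axis"
    "finite B" "card B = n" "B \<subseteq> pos_imag_axis" "V = {0} \<union> A \<union> B"
    using assms unfolding is_V_config_def by blast
  have "\<exists>p\<in>A. \<exists>q. outermost Re Im ({0} \<union> A \<union> B) p q"
    using AB by (intro ex_outermost) (auto simp: pos_real_axis_def pos_imag_axis_def)
  then obtain p q where pq: "p \<in> A" "outermost Re Im V p q" unfolding AB(7) by blast
  moreover have "p \<in> V" "0 < Re p" using pq(1) AB by (auto simp: pos_real_axis_def)
  ultimately show ?thesis using that by blast
qed

lemma V_config_ex_outermost_imag: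
  assumes "is_V_config m (Suc n) V"
  obtains b b' where "b \<in> V" "0 < Im b" "outermost Im Re V b b'"
proof -
  obtain A B where AB: "finite A" "card A = m" "A \<subseteq> pos_real_axis"
    "finite B" "card B = Suc n" "B \<subseteq> pos_imag_axis" "V = {0} \<union> A \<union> B"
    using assms unfolding is_V_config_def by blast
  have "\<exists>p\<in>B. \<exists>q. outermost Im Re ({0} \<union> B \<union> A) p q"
    using AB by (intro ex_outermost) (auto simp: pos_real_axis_def pos_imag_axis_def)
  moreover have "{0} \<union> B \<union> A = V" using AB(7) by blast
  ultimately obtain p q where pq: "p \<in> B" "outermost Im Re V p q" by auto
  moreover have "p \<in> V" "0 < Im p" using pq(1) AB by (auto simp: pos_imag_axis_def)
  ultimately show ?thesis using that by blast
qed

section \<open>The counting numbers and their generating function\<close>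

fun nc_count :: "nat \<Rightarrow> nat \<Rightarrow> rat" where
  "nc_count 0 0 = 1"
| "nc_count (Suc m) 0 = 2 * nc_count m 0"
| "nc_count 0 (Suc n) = 2 * nc_count 0 n"
| "nc_count (Suc m) (Suc n) =
     2 * nc_count m (Suc n) + 2 * nc_count (Suc m) n - 3 * nc_count m n"

lemma card_NC_singleton: "card (NC {z}) = 1"
proof -
  have "\<pi> = {{z}}" if "\<pi> \<in> NC {z}" for \<pi>
    using NC_block_subset[OF that] NC_partition[OF that]
    by (auto simp: partition_on_def subset_singleton_iff)
  moreover have "{{z}} \<in> NC {z}" by (rule NC_I) auto
  ultimately have "NC {z} = {{{z}}}" by blast
  then show ?thesis by simp
qed

text \<open>Induction along the recursion of \<open>nc_count\<close>, with \<open>V\<close>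
  arbitrary because removing points changes the configuration. In particular the count does not
  depend on the positions of the points. Values in \<open>rat\<close> make the subtraction in the
  recursion genuine.\<close>

lemma card_NC_V_config: "is_V_config m n V \<Longrightarrow> of_nat (card (NC V)) = nc_count m n"
proof (induction m n arbitrary: V rule: nc_count.induct)
  case 1
  then have "V = {0}" by (auto simp: is_V_config_def)
  then show ?case by (simp add: card_NC_singleton)
next
  case (2 m)
  obtain a a' where a: "a \<in> V" "0 < Re a" "outermost Re Im V a a'"
    using V_config_ex_outermost_real[OF 2(2)] .
  have "Im z = 0" if "z \<in> V" for z
    using 2(2) that by (auto simp: is_V_config_def pos_real_axis_def)
  then have "card (NC V) = 2 * card (NC (V - {a}))" using card_NC_one_axis[OF a(3)] by blast
  then show ?case using 2(1) V_config_remove_real[OF 2(2) a(1,2)] by simp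
next
  case (3 n)
  obtain b b' where b: "b \<in> V" "0 < Im b" "outermost Im Re V b b'"
    using V_config_ex_outermost_imag[OF 3(2)] .
  have "Re z = 0" if "z \<in> V" for z
    using 3(2) that by (auto simp: is_V_config_def pos_imag_axis_def)
  then have "card (NC V) = 2 * card (NC (V - {b}))" using card_NC_one_axis[OF b(3)] by blast
  then show ?case using 3(1) V_config_remove_imag[OF 3(2) b(1,2)] by simp
next
  case (4 m n)
  obtain a a' where a: "a \<in> V" "0 < Re a" "outermost Re Im V a a'"
    using V_config_ex_outermost_real[OF 4(4)] .
  obtain b b' where b: "b \<in> V" "0 < Im b" "outermost Im Re V b b'"
    using V_config_ex_outermost_imag[OF 4(4)] .
  have Va: "is_V_config m (Suc n) (V - {a})" using V_config_remove_real[OF 4(4) a(1,2)] by simp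
  have Vb: "is_V_config (Suc m) n (V - {b})" using V_config_remove_imag[OF 4(4) b(1,2)] by simp
  have "Im a = 0" using a(3) by (simp add: outermost_def)
  then have "b \<in> V - {a}" using b by auto
  then have Vab: "is_V_config m n (V - {a} - {b})"
    using V_config_remove_imag[OF Va _ b(2)] by simp
  have "of_nat (card (NC V) + 3 * card (NC (V - {a} - {b}))) =
      (of_nat (2 * card (NC (V - {a})) + 2 * card (NC (V - {b}))) :: rat)"
    using card_NC_recurrence[OF a(3) b(3)] by (rule arg_cong)
  then show ?case using 4(1)[OF Va] 4(2)[OF Vb] 4(3)[OF Vab] by simp
qed

text \<open>Multiplication by \<open>fps_x\<close> shifts the inner index \<open>m\<close>, and by
  \<open>fps_y\<close> the outer index \<open>n\<close>. Comparing coefficients in the four zero or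
  successor cases gives exactly the four equations of \<open>nc_count\<close>.\<close>

lemma nc_count_gf:
  "bivariate_gf nc_count * (1 - 2 * fps_x - 2 * fps_y + 3 * fps_x * fps_y) = 1"
proof -
  let ?G = "bivariate_gf nc_count"
  have G: "fps_nth (fps_nth ?G n) m = nc_count m n" for m n by (simp add: bivariate_gf_def)
  have 2: "(2 :: rat fps fps) = fps_const (fps_const 2)"
    and 3: "(3 :: rat fps fps) = fps_const (fps_const 3)"
    by (simp_all add: fps_numeral_fps_const)
  \<comment> \<open>Written as nested constants times shifts of \<open>?G\<close>, each term has
    coefficients that simplification can read off.\<close>
  have eq: "?G * (1 - 2 * fps_x - 2 * fps_y + 3 * fps_x * fps_y) =
      ?G - fps_const (fps_const 2) * (fps_const fps_X * ?G)
      - fps_const (fps_const 2) * (fps_X * ?G)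
      + fps_const (fps_const 3) * (fps_X * (fps_const fps_X * ?G))"
    unfolding 2 3 fps_x_def fps_y_def by (simp add: algebra_simps del: fps_const_mult)
  show ?thesis
  proof (intro fps_ext)
    fix n m
    show "fps_nth (fps_nth (?G * (1 - 2 * fps_x - 2 * fps_y + 3 * fps_x * fps_y)) n) m =
        fps_nth (fps_nth 1 n) m"
      unfolding eq by (cases n; cases m) (simp_all add: G)
  qed
qed

text \<open>The coefficients of \<open>D\<close> are themselves power series, so its constant
  coefficient must be a unit and not merely nonzero; a nonzero constant term of that coefficient
  guarantees this.\<close>

lemma fps_fps_eq_one_divideI:
  fixes F D :: "'a::field fps fps"
  assumes D: "fps_nth (fps_nth D 0) 0 \<noteq> 0" and FD: "F * D = 1"
  shows "F = 1 / D"
proof -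
  have "D * inverse D = 1"
    unfolding fps_inverse_def[of D] by (intro fps_right_inverse inverse_mult_eq_1' D)
  then have "F = inverse D"
    using FD by (metis mult.assoc mult_1_left mult_1_right)
  \<comment> \<open>With subdegree 0, division involves no shift and is multiplication by
    \<open>inverse D\<close>.\<close>
  moreover have "subdegree D = 0" using D by (intro subdegree_eq_0) auto
  ultimately show ?thesis by (simp add: fps_divide_def)
qed

theorem theorem3p4:
  fixes V :: "nat \<Rightarrow> nat \<Rightarrow> complex set"
  assumes "\<And>m n. is_V_config m n (V m n)"
  shows "bivariate_gf (\<lambda>m n. of_nat (card (NC (V m n)))) =
           1 / (1 - 2 * fps_x - 2 * fps_y + 3 * fps_x * fps_y)"
proof -
  let ?D = "1 - 2 * fps_x - 2 * fps_y + 3 * fps_x * fps_y :: rat fps fps"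
  \<comment> \<open>The part of the denominator free of \<open>y\<close> is a series in
    \<open>x\<close> with constant term 1, hence a unit.\<close>
  have D0: "fps_nth ?D 0 = 1 - 2 * fps_X"
    by (simp add: fps_x_def fps_y_def fps_mult_nth)
  have D00: "fps_nth (fps_nth ?D 0) 0 = 1" unfolding D0 by (simp add: fps_mult_nth)
  have "bivariate_gf nc_count = 1 / ?D"
    by (rule fps_fps_eq_one_divideI[OF _ nc_count_gf]) (simp only: D00 one_neq_zero not_False_eq_True)
  moreover have "(\<lambda>m n. of_nat (card (NC (V m n)))) = nc_count"
    using card_NC_V_config[OF assms] by (intro ext)
  ultimately show ?thesis by simp
qed

end
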